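(* The Banach-Mazur distance between the real Banach spaces $L_\infty[0,1]$ (with respect to Lebesgue measure) and $\ell_\infty$ satisfies $$d_{\rm BM}\big(L_\infty[0,1],\ell_\infty\big)\ \ge\ 7.41.$$
   Context: For isomorphic Banach spaces $X,Y$, the Banach-Mazur distance $d_{\rm BM}(X,Y)$ is the infimum of $\|T\|\cdot\|T^{-1}\|$ over all linear isomorphisms (linear homeomorphisms) $T:X\to Y$ onto $Y$. $L_\infty[0,1]$ carries the essential supremum norm and $\ell_\infty$ the supremum norm; both are real Banach spaces, and they are isomorphic (Pełczyński). *)

theory Defs
  imports "HOL-Analysis.Analysis" "HOL-Probability.Essential_Supremum"
begin

section \<open>The space of essentially bounded functions on the unit interval\<close>

abbreviation leb01 :: "real measure"
  where "leb01 \<equiv> lebesgue_on {0..1}"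

definition ess_bounded01 :: "(real \<Rightarrow> real) \<Rightarrow> bool"
  where "ess_bounded01 f \<longleftrightarrow>
    f \<in> borel_measurable leb01 \<and> esssup leb01 (\<lambda>x. ereal \<bar>f x\<bar>) < \<infinity>"

definition ess_norm01 :: "(real \<Rightarrow> real) \<Rightarrow> real"
  where "ess_norm01 f = real_of_ereal (esssup leb01 (\<lambda>x. ereal \<bar>f x\<bar>))"

lemma ess_bounded01_measurable: "ess_bounded01 f \<Longrightarrow> f \<in> borel_measurable leb01"
  by (simp add: ess_bounded01_def)

lemma esssup_leb01_nonneg:
  assumes "f \<in> borel_measurable leb01"
  shows "0 \<le> esssup leb01 (\<lambda>x. ereal \<bar>f x\<bar>)"
proof -
  have "emeasure leb01 (space leb01) \<noteq> 0"
    by (simp add: emeasure_restrict_space)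
  then have "0 = esssup leb01 (\<lambda>x. 0::ereal)"
    by (simp add: esssup_const)
  also have "\<dots> \<le> esssup leb01 (\<lambda>x. ereal \<bar>f x\<bar>)"
    by (rule esssup_mono) auto
  finally show ?thesis .
qed

lemma ess_bounded01_esssup:
  assumes "ess_bounded01 f"
  shows "esssup leb01 (\<lambda>x. ereal \<bar>f x\<bar>) = ereal (ess_norm01 f)"
  using assms esssup_leb01_nonneg[of f] unfolding ess_norm01_def ess_bounded01_def
  by (cases "esssup leb01 (\<lambda>x. ereal \<bar>f x\<bar>)") auto

lemma ess_norm01_nonneg: "ess_bounded01 f \<Longrightarrow> 0 \<le> ess_norm01 f"
  using esssup_leb01_nonneg[of f] ess_bounded01_esssup[of f]
  by (simp add: ess_bounded01_def)

lemma ess_norm01_AE: "ess_bounded01 f \<Longrightarrow> AE x in leb01. \<bar>f x\<bar> \<le> ess_norm01 f"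
  using esssup_AE[of "\<lambda>x. ereal \<bar>f x\<bar>" leb01] ess_bounded01_esssup[of f] by simp

lemma ess_bounded01I:
  assumes "f \<in> borel_measurable leb01" "AE x in leb01. \<bar>f x\<bar> \<le> C"
  shows "ess_bounded01 f"
proof -
  have "esssup leb01 (\<lambda>x. ereal \<bar>f x\<bar>) \<le> ereal C"
    using assms by (intro esssup_I) auto
  also have "\<dots> < \<infinity>" by simp
  finally show ?thesis using assms(1) by (simp add: ess_bounded01_def)
qed

lemma ess_norm01_le:
  assumes "f \<in> borel_measurable leb01" "AE x in leb01. \<bar>f x\<bar> \<le> C"
  shows "ess_norm01 f \<le> C"
proof -
  have "ereal (ess_norm01 f) \<le> ereal C"
    unfolding ess_bounded01_esssup[OF ess_bounded01I[OF assms], symmetric]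
    using assms by (intro esssup_I) auto
  then show ?thesis by simp
qed

lemma ess_bounded01_zero: "ess_bounded01 (\<lambda>_. 0)"
  by (rule ess_bounded01I[where C = 0]) auto

lemma ess_add01:
  assumes "ess_bounded01 f" "ess_bounded01 g"
  shows "ess_bounded01 (\<lambda>x. f x + g x)"
    and "ess_norm01 (\<lambda>x. f x + g x) \<le> ess_norm01 f + ess_norm01 g"
proof -
  have m: "(\<lambda>x. f x + g x) \<in> borel_measurable leb01"
    using assms by (intro borel_measurable_add ess_bounded01_measurable)
  have a: "AE x in leb01. \<bar>f x + g x\<bar> \<le> ess_norm01 f + ess_norm01 g"
    using ess_norm01_AE[OF assms(1)] ess_norm01_AE[OF assms(2)] by eventually_elim linarith
  show "ess_bounded01 (\<lambda>x. f x + g x)"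
    and "ess_norm01 (\<lambda>x. f x + g x) \<le> ess_norm01 f + ess_norm01 g"
    by (rule ess_bounded01I[OF m a], rule ess_norm01_le[OF m a])
qed

lemma ess_scale01:
  assumes "ess_bounded01 f"
  shows "ess_bounded01 (\<lambda>x. c * f x)" and "ess_norm01 (\<lambda>x. c * f x) \<le> \<bar>c\<bar> * ess_norm01 f"
proof -
  have m: "(\<lambda>x. c * f x) \<in> borel_measurable leb01"
    using ess_bounded01_measurable[OF assms] by (intro borel_measurable_times) auto
  have a: "AE x in leb01. \<bar>c * f x\<bar> \<le> \<bar>c\<bar> * ess_norm01 f"
    using ess_norm01_AE[OF assms] by eventually_elim (simp add: abs_mult mult_left_mono)
  show "ess_bounded01 (\<lambda>x. c * f x)" and "ess_norm01 (\<lambda>x. c * f x) \<le> \<bar>c\<bar> * ess_norm01 f"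
    by (rule ess_bounded01I[OF m a], rule ess_norm01_le[OF m a])
qed

lemma ess_norm01_scale:
  assumes "ess_bounded01 f"
  shows "ess_norm01 (\<lambda>x. c * f x) = \<bar>c\<bar> * ess_norm01 f"
proof (cases "c = 0")
  case True
  have "ess_norm01 (\<lambda>_. 0) \<le> 0" by (rule ess_norm01_le) auto
  with ess_norm01_nonneg[OF ess_bounded01_zero] True show ?thesis by simp
next
  case False
  have "ess_norm01 f = ess_norm01 (\<lambda>x. inverse c * (c * f x))"
    using False by (simp add: mult.assoc[symmetric])
  also have "\<dots> \<le> \<bar>inverse c\<bar> * ess_norm01 (\<lambda>x. c * f x)"
    by (rule ess_scale01(2)[OF ess_scale01(1)[OF assms]])
  finally have "\<bar>c\<bar> * ess_norm01 f \<le> ess_norm01 (\<lambda>x. c * f x)"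
    using False by (simp add: field_simps)
  with ess_scale01(2)[OF assms, of c] show ?thesis by simp
qed

lemma ess_uminus01: "ess_bounded01 f \<Longrightarrow> ess_bounded01 (\<lambda>x. - f x)"
  using ess_scale01(1)[of f "-1"] by simp

lemma ess_diff01:
  assumes "ess_bounded01 f" "ess_bounded01 g"
  shows "ess_bounded01 (\<lambda>x. f x - g x)"
  using ess_add01(1)[OF assms(1) ess_uminus01[OF assms(2)]] by simp

definition ess_eq01 :: "(real \<Rightarrow> real) \<Rightarrow> (real \<Rightarrow> real) \<Rightarrow> bool"
  where "ess_eq01 f g \<longleftrightarrow>
    ess_bounded01 f \<and> ess_bounded01 g \<and> (AE x in leb01. f x = g x)"

text \<open>
  Elements are classes of essentially bounded Lebesgue measurable functions modulo equality almost
  everywhere on \<open>{0..1}\<close>; the values of a representative outside \<open>{0..1}\<close> are irrelevant.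
\<close>

quotient_type linf01 = "real \<Rightarrow> real" / partial: ess_eq01
proof (rule part_equivpI)
  show "\<exists>f. ess_eq01 f f"
    using ess_bounded01_zero by (auto simp: ess_eq01_def)
  show "symp ess_eq01"
    by (rule sympI) (auto simp: ess_eq01_def elim: AE_mp)
  show "transp ess_eq01"
  proof (rule transpI)
    fix f g h assume fg: "ess_eq01 f g" and gh: "ess_eq01 g h"
    from fg gh have "AE x in leb01. f x = g x" "AE x in leb01. g x = h x"
      by (auto simp: ess_eq01_def)
    then have "AE x in leb01. f x = h x" by eventually_elim simp
    with fg gh show "ess_eq01 f h" by (simp add: ess_eq01_def)
  qed
qed

instantiation linf01 :: real_vector
begin

lift_definition zero_linf01 :: linf01 is "\<lambda>_. 0"
  by (simp add: ess_eq01_def ess_bounded01_zero)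

lift_definition plus_linf01 :: "linf01 \<Rightarrow> linf01 \<Rightarrow> linf01" is "\<lambda>f g x. f x + g x"
  unfolding ess_eq01_def by (auto intro: ess_add01)

lift_definition uminus_linf01 :: "linf01 \<Rightarrow> linf01" is "\<lambda>f x. - f x"
  unfolding ess_eq01_def by (auto intro: ess_uminus01)

lift_definition minus_linf01 :: "linf01 \<Rightarrow> linf01 \<Rightarrow> linf01" is "\<lambda>f g x. f x - g x"
  unfolding ess_eq01_def by (auto intro: ess_diff01)

lift_definition scaleR_linf01 :: "real \<Rightarrow> linf01 \<Rightarrow> linf01" is "\<lambda>c f x. c * f x"
  unfolding ess_eq01_def by (auto intro: ess_scale01)

instance
  by standard
    (transfer; auto simp: ess_eq01_def algebra_simps
      intro!: ess_add01 ess_diff01 ess_uminus01 ess_scale01 ess_bounded01_zero)+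

end

instantiation linf01 :: real_normed_vector
begin

lift_definition norm_linf01 :: "linf01 \<Rightarrow> real" is ess_norm01
proof -
  fix f g assume "ess_eq01 f g"
  then have f: "f \<in> borel_measurable leb01" and g: "g \<in> borel_measurable leb01"
    and ae: "AE x in leb01. f x = g x"
    by (auto simp: ess_eq01_def ess_bounded01_def)
  from ae have "AE x in leb01. ereal \<bar>f x\<bar> = ereal \<bar>g x\<bar>"
    by eventually_elim simp
  with f g have "esssup leb01 (\<lambda>x. ereal \<bar>f x\<bar>) = esssup leb01 (\<lambda>x. ereal \<bar>g x\<bar>)"
    by (intro esssup_AE_cong) auto
  then show "ess_norm01 f = ess_norm01 g" by (simp add: ess_norm01_def)
qed

definition dist_linf01 :: "linf01 \<Rightarrow> linf01 \<Rightarrow> real"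
  where "dist_linf01 f g = norm (f - g)"

definition sgn_linf01 :: "linf01 \<Rightarrow> linf01"
  where "sgn_linf01 f = f /\<^sub>R norm f"

definition uniformity_linf01 :: "(linf01 \<times> linf01) filter"
  where "uniformity_linf01 = (INF e\<in>{0 <..}. principal {(x, y). dist x y < e})"

definition open_linf01 :: "linf01 set \<Rightarrow> bool"
  where "open_linf01 S = (\<forall>x\<in>S. \<forall>\<^sub>F (x', y) in uniformity. x' = x \<longrightarrow> y \<in> S)"

instance
proof
  fix f g :: linf01 and a :: real
  show "norm f = 0 \<longleftrightarrow> f = 0"
  proof transfer
    fix f assume "ess_eq01 f f"
    then have f: "ess_bounded01 f" by (simp add: ess_eq01_def)
    show "ess_norm01 f = 0 \<longleftrightarrow> ess_eq01 f (\<lambda>_. 0)"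
    proof
      assume "ess_norm01 f = 0"
      with ess_norm01_AE[OF f] have "AE x in leb01. f x = 0" by simp
      with f show "ess_eq01 f (\<lambda>_. 0)" by (simp add: ess_eq01_def ess_bounded01_zero)
    next
      assume "ess_eq01 f (\<lambda>_. 0)"
      then have "AE x in leb01. \<bar>f x\<bar> \<le> 0" by (simp add: ess_eq01_def)
      with f have "ess_norm01 f \<le> 0" by (intro ess_norm01_le ess_bounded01_measurable)
      with ess_norm01_nonneg[OF f] show "ess_norm01 f = 0" by simp
    qed
  qed
  show "norm (f + g) \<le> norm f + norm g"
    by transfer (simp add: ess_eq01_def ess_add01)
  show "norm (a *\<^sub>R f) = \<bar>a\<bar> * norm f"
    by transfer (simp add: ess_eq01_def ess_norm01_scale)
qed (rule dist_linf01_def sgn_linf01_def uniformity_linf01_def open_linf01_def)+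

end

lemma norm_diff_abs_linf01:
  assumes "ess_bounded01 f" "ess_bounded01 g"
  shows "norm (abs_linf01 f - abs_linf01 g) = ess_norm01 (\<lambda>x. f x - g x)"
proof -
  have f: "ess_eq01 f f" and g: "ess_eq01 g g"
    and d: "ess_eq01 (\<lambda>x. f x - g x) (\<lambda>x. f x - g x)"
    using assms ess_diff01[OF assms] by (simp_all add: ess_eq01_def)
  show ?thesis
    by (simp only: minus_linf01.abs_eq[OF f g] norm_linf01.abs_eq[OF d])
qed

instance linf01 :: banach
proof
  fix X :: "nat \<Rightarrow> linf01"
  assume X: "Cauchy X"
  define F where "F n = rep_linf01 (X n)" for n
  have FX: "ess_eq01 (F n) (F n)" "abs_linf01 (F n) = X n" for n
    using Quotient3_rep_reflp[OF Quotient3_linf01] Quotient3_abs_rep[OF Quotient3_linf01]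
    by (auto simp: F_def)
  then have F: "ess_bounded01 (F n)" for n
    by (simp add: ess_eq01_def)
  have norm_diff: "norm (X m - X n) = ess_norm01 (\<lambda>x. F m x - F n x)" for m n
    using norm_diff_abs_linf01[OF F F, of m n] by (simp only: FX)
  have ae: "AE x in leb01. \<forall>m n. \<bar>F m x - F n x\<bar> \<le> norm (X m - X n)"
    unfolding AE_all_countable norm_diff using ess_norm01_AE[OF ess_diff01[OF F F]] by blast
  have C: "\<exists>M. \<forall>m\<ge>M. \<forall>n\<ge>M. norm (X m - X n) < e" if "e > 0" for e
    using X that by (auto simp: Cauchy_def dist_norm)
  have conv: "AE x in leb01. convergent (\<lambda>n. F n x) \<and>
      (\<forall>m n. \<bar>F m x - F n x\<bar> \<le> norm (X m - X n))"
    using ae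
  proof eventually_elim
    case (elim x)
    have "Cauchy (\<lambda>n. F n x)"
      unfolding Cauchy_def dist_real_def
      using C elim by (meson le_less_trans)
    with elim show ?case by (simp add: Cauchy_convergent_iff)
  qed
  define L where "L x = lim (\<lambda>n. F n x)" for x
  have mF [measurable]: "F n \<in> borel_measurable leb01" for n
    using F by (rule ess_bounded01_measurable)
  have mL [measurable]: "L \<in> borel_measurable leb01"
    unfolding L_def by (rule borel_measurable_lim_metric) (rule mF)
  have close: "AE x in leb01. \<bar>F m x - L x\<bar> \<le> e"
    if M: "\<And>n. n \<ge> m \<Longrightarrow> norm (X m - X n) < e" for m e
    using conv
  proof eventually_elim
    case (elim x)
    then have "(\<lambda>n. F n x) \<longlonglongrightarrow> L x"
      unfolding L_def by (simp add: convergent_LIMSEQ_iff)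
    then have "(\<lambda>n. \<bar>F m x - F n x\<bar>) \<longlonglongrightarrow> \<bar>F m x - L x\<bar>"
      by (intro tendsto_intros)
    moreover have "\<forall>n\<ge>m. \<bar>F m x - F n x\<bar> \<le> e"
      using elim M by (meson le_less_trans less_imp_le)
    ultimately show ?case
      by (intro LIMSEQ_le_const2) auto
  qed
  have L: "ess_bounded01 L"
  proof -
    obtain m where m: "\<And>n. n \<ge> m \<Longrightarrow> norm (X m - X n) < 1"
      using C[of 1] by auto
    have "AE x in leb01. \<bar>F m x - L x\<bar> \<le> 1"
      by (rule close) (rule m)
    then have "AE x in leb01. \<bar>L x\<bar> \<le> ess_norm01 (F m) + 1"
      using ess_norm01_AE[OF F[of m]] by eventually_elim linarith
    with mL show ?thesis by (rule ess_bounded01I)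
  qed
  have "X \<longlonglongrightarrow> abs_linf01 L"
    unfolding LIMSEQ_def dist_norm
  proof (intro allI impI)
    fix e :: real assume "e > 0"
    then obtain M where M: "\<And>m n. m \<ge> M \<Longrightarrow> n \<ge> M \<Longrightarrow> norm (X m - X n) < e / 2"
      using C[of "e / 2"] by auto
    have "norm (X m - abs_linf01 L) < e" if "m \<ge> M" for m
    proof -
      have "norm (X m - abs_linf01 L) = ess_norm01 (\<lambda>x. F m x - L x)"
        using norm_diff_abs_linf01[OF F L, of m] by (simp only: FX)
      also have "\<dots> \<le> e / 2"
        using M that by (intro ess_norm01_le close) auto
      finally show ?thesis using \<open>e > 0\<close> by simp
    qed
    then show "\<exists>M. \<forall>m\<ge>M. norm (X m - abs_linf01 L) < e" by blast
  qed
  then show "convergent X" by (rule convergentI)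
qed


section \<open>The space of bounded sequences\<close>

text \<open>The topology on \<^typ>\<open>nat\<close> is discrete, so continuity is no restriction.\<close>

type_synonym ell_inf = "nat \<Rightarrow>\<^sub>C real"


section \<open>The Banach-Mazur distance\<close>

text \<open>The value is \<open>\<infinity>\<close> if the two spaces are not isomorphic.\<close>

definition banach_mazur_dist ::
    "'a::real_normed_vector itself \<Rightarrow> 'b::real_normed_vector itself \<Rightarrow> ereal"
  where "banach_mazur_dist _ _ =
    (INF T \<in> {T :: 'a \<Rightarrow> 'b. bounded_linear T \<and> bij T \<and> bounded_linear (inv T)}.
      ereal (onorm T * onorm (inv T)))"

end

theory Submission
  imports Defs
begin

text \<open>
  Normalise an isomorphism \<open>T\<close> so that \<open>Q = inv T\<close> has norm at most \<open>1\<close> and \<open>T\<close> has norm at most \<open>M\<close>;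
  put \<open>g n = Q (unit_seq n)\<close>. Two facts drive the proof. First, \<open>\<Sum>n. \<bar>g n\<bar> \<le> 1\<close>, and the part of
  \<open>Q y\<close> not explained by the coordinates in \<open>K\<close> is at most \<open>(1 - \<Sum>n\<in>K. \<bar>g n\<bar>) * norm y\<close>. Second, since
  Lebesgue measure has no atoms, changing a function on a suitable tiny set hardly affects any
  prescribed finite set of coordinates of its image.

  Start from \<open>u = F + \<Sum>n\<in>J. \<alpha> n * s n * g n\<close> of norm \<open>1\<close> and reverse its sign on a tiny set on which
  the sum is almost \<open>\<plusminus>1\<close>. This changes \<open>F\<close> by almost \<open>2\<close> there, and as the finitely many old
  coordinates cannot react, some far coordinate \<open>m\<close> of \<open>T F\<close> becomes large. Rescale \<open>u\<close> so that
  \<open>T F\<close> has norm \<open>w\<close>, and add the largest multiple of \<open>g m\<close> that keeps the norm of \<open>u\<close> at most \<open>1\<close>.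
  That multiple is at most \<open>M - w\<close>, because \<open>g m\<close> raises the \<open>m\<close>-th coordinate by the same amount.
  Feeding this back, a configuration of level \<open>w\<close> allows the next level to be almost
  \<open>2 * M / (M - w)\<close>. This exceeds \<open>w\<close> for all \<open>w\<close> when \<open>M < 8\<close>, so the levels would grow beyond \<open>M\<close>.
\<close>

section \<open>Representatives of classes and their arithmetic almost everywhere\<close>

lemma rep_linf01_bounded: "ess_bounded01 (rep_linf01 f)"
  using Quotient3_rep_reflp[OF Quotient3_linf01, of f] by (simp add: ess_eq01_def)

lemma rep_linf01_measurable [measurable]: "rep_linf01 f \<in> borel_measurable leb01"
  by (rule ess_bounded01_measurable[OF rep_linf01_bounded])

lemma abs_rep_linf01: "abs_linf01 (rep_linf01 f) = f"
  using Quotient3_abs_rep[OF Quotient3_linf01] .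

lemma rep_abs_linf01:
  assumes "ess_bounded01 f"
  shows "AE x in leb01. rep_linf01 (abs_linf01 f) x = f x"
proof -
  have "ess_eq01 f f" using assms by (simp add: ess_eq01_def)
  then have "ess_eq01 (rep_linf01 (abs_linf01 f)) f"
    using Quotient3_rep_abs[OF Quotient3_linf01] by blast
  then show ?thesis by (simp add: ess_eq01_def)
qed

lemma rep_linf01_refl: "ess_eq01 (rep_linf01 f) (rep_linf01 f)"
  using rep_linf01_bounded by (simp add: ess_eq01_def)

lemma norm_linf01_rep: "norm f = ess_norm01 (rep_linf01 f)"
  using norm_linf01.abs_eq[OF rep_linf01_refl, of f] by (simp add: abs_rep_linf01)

lemma norm_linf01_le_iff: "norm f \<le> C \<longleftrightarrow> (AE x in leb01. \<bar>rep_linf01 f x\<bar> \<le> C)"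
proof
  assume C: "norm f \<le> C"
  show "AE x in leb01. \<bar>rep_linf01 f x\<bar> \<le> C"
    using ess_norm01_AE[OF rep_linf01_bounded, of f]
    by eventually_elim (use C in \<open>simp add: norm_linf01_rep\<close>)
qed (auto simp: norm_linf01_rep intro: ess_norm01_le)

lemma rep_linf01_add:
  "AE x in leb01. rep_linf01 (f + g) x = rep_linf01 f x + rep_linf01 g x"
  using rep_abs_linf01[OF ess_add01(1)[OF rep_linf01_bounded rep_linf01_bounded], of f g]
    plus_linf01.abs_eq[OF rep_linf01_refl rep_linf01_refl, of f g]
  by (simp add: abs_rep_linf01)

lemma rep_linf01_scaleR:
  "AE x in leb01. rep_linf01 (c *\<^sub>R f) x = c * rep_linf01 f x"
  using rep_abs_linf01[OF ess_scale01(1)[OF rep_linf01_bounded], of c f]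
    scaleR_linf01.abs_eq[OF rep_linf01_refl, of c f]
  by (simp add: abs_rep_linf01)

lemma rep_linf01_zero: "AE x in leb01. rep_linf01 0 x = 0"
  using rep_abs_linf01[OF ess_bounded01_zero] by (simp add: zero_linf01.abs_eq)

lemma rep_linf01_sum:
  assumes "finite I"
  shows "AE x in leb01. rep_linf01 (\<Sum>i\<in>I. c i *\<^sub>R f i) x = (\<Sum>i\<in>I. c i * rep_linf01 (f i) x)"
  using assms
proof (induction I rule: finite_induct)
  case (insert i I)
  from insert.IH rep_linf01_add[of "c i *\<^sub>R f i" "\<Sum>i\<in>I. c i *\<^sub>R f i"] rep_linf01_scaleR[of "c i" "f i"]
  show ?case by eventually_elim (simp add: insert.hyps)
qed (simp add: rep_linf01_zero)

section \<open>Sets of positive measure and the absence of atoms\<close>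

definition ind01 :: "real set \<Rightarrow> linf01"
  where "ind01 W = abs_linf01 (indicator W)"

lemma rep_ind01:
  assumes "W \<in> sets leb01"
  shows "AE x in leb01. rep_linf01 (ind01 W) x = indicator W x"
  unfolding ind01_def
  by (rule rep_abs_linf01, rule ess_bounded01I[where C = 1]) (use assms in \<open>auto simp: indicator_def\<close>)

text \<open>Positive measure, phrased through \<open>AE\<close> so that a.e. statements directly
  yield a point of the set.\<close>

definition nonnull01 :: "real set \<Rightarrow> bool"
  where "nonnull01 W \<longleftrightarrow> W \<in> sets leb01 \<and> \<not> (AE x in leb01. x \<notin> W)"

lemma nonnull01_AE_obtain:
  assumes "nonnull01 W" "AE x in leb01. P x"
  obtains x where "x \<in> W" "P x"
proof -
  have "\<exists>x\<in>W. P x"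
  proof (rule ccontr)
    assume "\<not> (\<exists>x\<in>W. P x)"
    with assms(2) have "AE x in leb01. x \<notin> W" by (auto elim: AE_mp)
    with assms(1) show False by (simp add: nonnull01_def)
  qed
  with that show thesis by blast
qed

lemma AE_leb01_neq: "AE x in leb01. x \<noteq> p"
proof -
  have "AE x in lborel. x \<noteq> p" by (rule AE_lborel_singleton)
  then have "AE x in lebesgue. x \<noteq> p" by (rule AE_completion)
  then show ?thesis by (subst AE_restrict_space_iff) (auto elim: AE_mp)
qed

text \<open>Otherwise each rational cut of \<open>W\<close> has a null side. After these countably
  many null sides are discarded, two surviving points would be separated by a rational; so at most
  one point survives, and a point is null.\<close>

lemma nonnull01_split:
  assumes W: "nonnull01 W"
  shows "\<exists>W'\<subseteq>W. nonnull01 W' \<and> nonnull01 (W - W')"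
proof (rule ccontr)
  assume neg: "\<not> (\<exists>W'\<subseteq>W. nonnull01 W' \<and> nonnull01 (W - W'))"
  have Wm: "W \<in> sets leb01" using W by (simp add: nonnull01_def)
  then have WS: "W \<subseteq> space leb01" by (rule sets.sets_into_space)
  define L where "L c = {x \<in> space leb01. x \<le> c} \<inter> W" for c
  have idm: "(\<lambda>x. x) \<in> borel_measurable leb01"
    by (intro measurable_restrict_space1 measurable_completion) simp
  have Lm: "L c \<in> sets leb01" for c
    unfolding L_def using Wm idm by (intro sets.Int borel_measurable_le) auto
  have Ln: "\<not> nonnull01 (L c) \<or> \<not> nonnull01 (W - L c)" for c
    using neg unfolding L_def by blast
  have "AE x in leb01. \<forall>c\<in>\<rat>. (nonnull01 (L c) \<longrightarrow> x \<notin> W - L c) \<and> (\<not> nonnull01 (L c) \<longrightarrow> x \<notin> L c)"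
  proof (subst AE_ball_countable[OF countable_rat], rule ballI)
    fix c :: real
    show "AE x in leb01. (nonnull01 (L c) \<longrightarrow> x \<notin> W - L c) \<and> (\<not> nonnull01 (L c) \<longrightarrow> x \<notin> L c)"
      using Ln[of c] Lm[of c] Wm by (cases "nonnull01 (L c)") (auto simp: nonnull01_def)
  qed
  note ae = this
  let ?P = "\<lambda>x. \<forall>c\<in>\<rat>. (nonnull01 (L c) \<longrightarrow> x \<notin> W - L c) \<and> (\<not> nonnull01 (L c) \<longrightarrow> x \<notin> L c)"
  obtain p where p: "p \<in> W" "?P p" using nonnull01_AE_obtain[OF W ae] by blast
  have "AE x in leb01. ?P x \<and> x \<noteq> p"
    using ae AE_leb01_neq[of p] by eventually_elim simp
  then obtain q where q: "q \<in> W" "?P q" "q \<noteq> p" using nonnull01_AE_obtain[OF W] by blast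
  have no: False if "x \<in> W" "y \<in> W" "?P x" "?P y" "x < y" for x y
  proof -
    obtain c where c: "c \<in> \<rat>" "x < c" "c < y" using Rats_dense_in_real[OF \<open>x < y\<close>] by blast
    have "x \<in> L c" "y \<in> W - L c" using that c WS by (auto simp: L_def)
    with that(3,4) c(1) show False by blast
  qed
  from no[of p q] no[of q p] p q show False by (cases "p < q") auto
qed

text \<open>Repeated splitting gives a decreasing sequence \<open>B\<close>; its successive
  differences are disjoint.\<close>

lemma nonnull01_disjoint_seq:
  assumes "nonnull01 W"
  obtains A :: "nat \<Rightarrow> real set" where "disjoint_family A" "\<And>i. A i \<subseteq> W" "\<And>i. nonnull01 (A i)"
proof -
  have "\<exists>B. \<forall>n. (nonnull01 (B n) \<and> B n \<subseteq> W) \<and> (B (Suc n) \<subseteq> B n \<and> nonnull01 (B n - B (Suc n)))"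
  proof (rule dependent_nat_choice)
    show "\<exists>B. nonnull01 B \<and> B \<subseteq> W" using assms by blast
    show "\<exists>C. (nonnull01 C \<and> C \<subseteq> W) \<and> C \<subseteq> B \<and> nonnull01 (B - C)" if "nonnull01 B \<and> B \<subseteq> W" for B n
      using nonnull01_split[of B] that by blast
  qed
  then obtain B where B: "\<And>n. B n \<subseteq> W" "\<And>n. B (Suc n) \<subseteq> B n" "\<And>n. nonnull01 (B n - B (Suc n))"
    by blast
  have mono: "B j \<subseteq> B i" if "i \<le> j" for i j
    using B(2) that by (rule lift_Suc_antimono_le)
  have "disjoint_family (\<lambda>n. B n - B (Suc n))"
    unfolding disjoint_family_on_def
  proof (intro ballI impI)
    fix m n :: nat assume "m \<noteq> n"
    then consider "Suc m \<le> n" | "Suc n \<le> m" by linarith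
    then show "(B m - B (Suc m)) \<inter> (B n - B (Suc n)) = {}"
      by cases (use mono in blast)+
  qed
  with B that show thesis by blast
qed

section \<open>Unit vectors and coordinates of bounded sequences\<close>

definition unit_seq :: "nat \<Rightarrow> ell_inf"
  where "unit_seq n = Bcontfun (\<lambda>k. if k = n then 1 else 0)"

lemma bounded_seq_bcontfun: "(\<And>k. \<bar>f k\<bar> \<le> C) \<Longrightarrow> f \<in> bcontfun" for f :: "nat \<Rightarrow> real"
  by (rule bcontfun_normI[where b = C]) auto

lemma unit_seq_apply [simp]: "apply_bcontfun (unit_seq n) k = (if k = n then 1 else 0)"
  unfolding unit_seq_def
  by (subst Bcontfun_inverse) (auto intro: bounded_seq_bcontfun[where C = 1])

lemma apply_bcontfun_sum: "apply_bcontfun (\<Sum>i\<in>I. f i) k = (\<Sum>i\<in>I. apply_bcontfun (f i) k)"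
  by (induction I rule: infinite_finite_induct) auto

lemma ell_inf_apply_le: "\<bar>apply_bcontfun y n\<bar> \<le> norm y" for y :: ell_inf
  using norm_bounded[of y n] by simp

lemma ell_inf_norm_le: "(\<And>n. \<bar>apply_bcontfun y n\<bar> \<le> C) \<Longrightarrow> norm y \<le> C" for y :: ell_inf
  by (rule norm_bound) simp

lemma ell_inf_norm_less_obtain:
  fixes y :: ell_inf
  assumes "C < norm y"
  obtains n where "C < \<bar>apply_bcontfun y n\<bar>"
  using ell_inf_norm_le[of y C] assms by (meson linorder_not_le)

section \<open>The normalised isomorphism and pointwise bounds for the functions
  \<open>g n\<close>\<close>

locale linf_ell_iso =
  fixes T :: "linf01 \<Rightarrow> ell_inf" and Q :: "ell_inf \<Rightarrow> linf01" and M :: real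
  assumes linear_T: "linear T" and linear_Q: "linear Q"
    and TQ: "T (Q y) = y" and QT: "Q (T f) = f"
    and norm_Q: "norm (Q y) \<le> norm y" and norm_T: "norm (T f) \<le> M * norm f"
begin

abbreviation g :: "nat \<Rightarrow> linf01" where "g n \<equiv> Q (unit_seq n)"

abbreviation coord :: "linf01 \<Rightarrow> nat \<Rightarrow> real" where "coord f n \<equiv> apply_bcontfun (T f) n"

lemma coord_add: "coord (f + h) n = coord f n + coord h n"
  by (simp add: linear_add[OF linear_T])

lemma coord_scaleR: "coord (c *\<^sub>R f) n = c * coord f n"
  by (simp add: linear_scale[OF linear_T])

lemma coord_sum: "coord (\<Sum>i\<in>I. c i *\<^sub>R f i) n = (\<Sum>i\<in>I. c i * coord (f i) n)"
  by (simp add: linear_sum[OF linear_T] linear_scale[OF linear_T] apply_bcontfun_sum)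

lemma coord_g: "coord (g n) k = (if k = n then 1 else 0)"
  by (simp add: TQ)

lemma coord_le: "\<bar>coord f n\<bar> \<le> M * norm f"
  using ell_inf_apply_le[of "T f" n] norm_T[of f] by linarith

lemma norm_g_le: "norm (g n) \<le> 1"
  by (rule order_trans[OF norm_Q ell_inf_norm_le]) simp

lemma M_ge_1: "1 \<le> M"
proof -
  have "1 \<le> M * norm (g 0)" using coord_le[of "g 0" 0] by (simp add: coord_g)
  moreover have "M * norm (g 0) \<le> M" if "0 \<le> M"
    using mult_left_mono[OF norm_g_le[of 0] that] by simp
  moreover have "M * norm (g 0) \<le> 0" if "M \<le> 0"
    using that by (simp add: mult_nonpos_nonneg)
  ultimately show ?thesis by linarith
qed

lemma coord_le_M:
  assumes "norm f \<le> 1"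
  shows "\<bar>coord f n\<bar> \<le> M"
proof -
  have "M * norm f \<le> M * 1" by (rule mult_left_mono) (use assms M_ge_1 in auto)
  with coord_le[of f n] show ?thesis by simp
qed

text \<open>Replacing the coordinates of \<open>z\<close> in \<open>K\<close> by \<open>X\<close>
  with arbitrary signs keeps the norm at most \<open>X\<close>, hence also that of the image under
  \<open>Q\<close>. There are finitely many sign patterns, so a.e. the pattern may be chosen to
  match the signs of \<open>g n\<close> at the point.\<close>

lemma Q_remainder_AE:
  assumes K: "finite K" and z: "\<And>n. \<bar>apply_bcontfun z n\<bar> \<le> X"
  shows "AE x in leb01. \<bar>rep_linf01 (Q z) x - (\<Sum>n\<in>K. apply_bcontfun z n * rep_linf01 (g n) x)\<bar>
    \<le> (1 - (\<Sum>n\<in>K. \<bar>rep_linf01 (g n) x\<bar>)) * X"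
proof -
  define s :: "nat set \<Rightarrow> nat \<Rightarrow> real" where "s P n = (if n \<in> P then 1 else -1)" for P n
  have X: "0 \<le> X" using z[of 0] by linarith
  \<comment> \<open>The sign \<open>t\<close> in front of \<open>z\<close> yields both bounds on the
    remainder, from above and from below.\<close>
  have sgn_AE: "AE x in leb01. \<bar>(\<Sum>n\<in>K. (X * s P n - t * apply_bcontfun z n) * rep_linf01 (g n) x)
      + t * rep_linf01 (Q z) x\<bar> \<le> X" if t: "t \<in> {1, -1}" for P t
  proof -
    define y where "y = (\<Sum>n\<in>K. (X * s P n - t * apply_bcontfun z n) *\<^sub>R unit_seq n) + t *\<^sub>R z"
    have "\<bar>apply_bcontfun y k\<bar> \<le> X" for k
    proof -
      have "apply_bcontfun y k = (if k \<in> K then X * s P k else t * apply_bcontfun z k)"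
        using K by (simp add: y_def apply_bcontfun_sum if_distrib cong: if_cong)
      then show ?thesis using z[of k] X t by (auto simp: s_def)
    qed
    then have "norm (Q y) \<le> X" using order_trans[OF norm_Q ell_inf_norm_le] by blast
    moreover have "Q y = (\<Sum>n\<in>K. (X * s P n - t * apply_bcontfun z n) *\<^sub>R g n) + t *\<^sub>R Q z"
      by (simp add: y_def linear_add[OF linear_Q] linear_sum[OF linear_Q] linear_scale[OF linear_Q])
    ultimately have "AE x in leb01. \<bar>rep_linf01 ((\<Sum>n\<in>K. (X * s P n - t * apply_bcontfun z n) *\<^sub>R g n) + t *\<^sub>R Q z) x\<bar> \<le> X"
      by (simp add: norm_linf01_le_iff)
    with rep_linf01_add[of "\<Sum>n\<in>K. (X * s P n - t * apply_bcontfun z n) *\<^sub>R g n" "t *\<^sub>R Q z"]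
      rep_linf01_sum[OF K, of "\<lambda>n. X * s P n - t * apply_bcontfun z n" g] rep_linf01_scaleR[of t "Q z"]
    show ?thesis by eventually_elim simp
  qed
  have "AE x in leb01. \<forall>P\<in>Pow K. \<forall>t\<in>{1, -1}.
      \<bar>(\<Sum>n\<in>K. (X * s P n - t * apply_bcontfun z n) * rep_linf01 (g n) x) + t * rep_linf01 (Q z) x\<bar> \<le> X"
    using K sgn_AE by (intro AE_finite_allI) auto
  then show ?thesis
  proof eventually_elim
    case (elim x)
    define P where "P = {n \<in> K. 0 \<le> rep_linf01 (g n) x}"
    define r where "r = rep_linf01 (Q z) x - (\<Sum>n\<in>K. apply_bcontfun z n * rep_linf01 (g n) x)"
    define S where "S = (\<Sum>n\<in>K. \<bar>rep_linf01 (g n) x\<bar>)"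
    have sg: "(\<Sum>n\<in>K. s P n * rep_linf01 (g n) x) = S"
      unfolding S_def by (rule sum.cong) (auto simp: P_def s_def)
    have eq: "(\<Sum>n\<in>K. (X * s P n - t * apply_bcontfun z n) * rep_linf01 (g n) x) + t * rep_linf01 (Q z) x
        = S * X + t * r" for t
      unfolding sg[symmetric] r_def
      by (simp add: algebra_simps sum_subtractf sum_distrib_left)
    have "P \<in> Pow K" by (auto simp: P_def)
    from bspec[OF elim this] have "\<forall>t\<in>{1, -1}. \<bar>S * X + t * r\<bar> \<le> X" by (simp only: eq)
    then have "\<bar>S * X + r\<bar> \<le> X" "\<bar>S * X - r\<bar> \<le> X" by simp_all
    moreover have "(1 - S) * X = X - S * X" by (simp add: left_diff_distrib)
    ultimately have "\<bar>r\<bar> \<le> (1 - S) * X" by linarith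
    then show ?case by (simp add: r_def S_def)
  qed
qed

text \<open>The remainder bound for \<open>z = 0\<close> and \<open>X = 1\<close>, whose left side
  is nonnegative.\<close>

lemma sum_abs_g_le_AE:
  assumes "finite K"
  shows "AE x in leb01. (\<Sum>n\<in>K. \<bar>rep_linf01 (g n) x\<bar>) \<le> 1"
proof -
  have "\<bar>apply_bcontfun (0::ell_inf) n\<bar> \<le> 1" for n by simp
  from Q_remainder_AE[OF assms this] show ?thesis by eventually_elim simp
qed

text \<open>The series of \<open>\<bar>g n\<bar>\<close> converges a.e., so its terms tend to 0 and
  the sets \<open>V N\<close> exhaust \<open>W\<close> up to a null set; one of them is not
  null.\<close>

lemma nonnull01_small_tail:
  assumes W: "nonnull01 W" and e: "0 < e"
  obtains W' N where "W' \<subseteq> W" "nonnull01 W'" "\<And>n x. N \<le> n \<Longrightarrow> x \<in> W' \<Longrightarrow> \<bar>rep_linf01 (g n) x\<bar> \<le> e"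
proof -
  define V where "V N = {x \<in> space leb01. \<forall>n. N \<le> n \<longrightarrow> \<bar>rep_linf01 (g n) x\<bar> \<le> e} \<inter> W" for N
  have Vm: "V N \<in> sets leb01" for N
    unfolding V_def using W by (intro sets.Int) (measurable, simp add: nonnull01_def)
  have "\<exists>N. nonnull01 (V N)"
  proof (rule ccontr)
    assume "\<not> (\<exists>N. nonnull01 (V N))"
    then have "AE x in leb01. \<forall>N. x \<notin> V N"
      using Vm by (simp add: nonnull01_def AE_all_countable)
    moreover have "AE x in leb01. \<forall>k. (\<Sum>n<k. \<bar>rep_linf01 (g n) x\<bar>) \<le> 1"
      unfolding AE_all_countable using sum_abs_g_le_AE by simp
    ultimately have "AE x in leb01. x \<notin> W" using AE_space
    proof eventually_elim
      case (elim x)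
      have "summable (\<lambda>n. \<bar>rep_linf01 (g n) x\<bar>)"
      proof (rule bounded_imp_summable)
        show "(\<Sum>n\<le>k. \<bar>rep_linf01 (g n) x\<bar>) \<le> 1" for k
          using elim(2)[rule_format, of "Suc k"] by (simp only: lessThan_Suc_atMost)
      qed simp
      then have "(\<lambda>n. \<bar>rep_linf01 (g n) x\<bar>) \<longlonglongrightarrow> 0" by (rule summable_LIMSEQ_zero)
      then have "\<forall>\<^sub>F n in sequentially. \<bar>rep_linf01 (g n) x\<bar> < e"
        using e by (simp add: order_tendstoD)
      then obtain N where "\<And>n. N \<le> n \<Longrightarrow> \<bar>rep_linf01 (g n) x\<bar> < e"
        by (auto simp: eventually_sequentially)
      then have "\<forall>n. N \<le> n \<longrightarrow> \<bar>rep_linf01 (g n) x\<bar> \<le> e" by (auto intro: less_imp_le)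
      with elim(1,3) show "x \<notin> W" unfolding V_def by blast
    qed
    with W show False by (simp add: nonnull01_def)
  qed
  then obtain N where N: "nonnull01 (V N)" by blast
  show thesis
  proof (rule that[OF _ N])
    show "V N \<subseteq> W" by (simp add: V_def)
    show "\<bar>rep_linf01 (g n) x\<bar> \<le> e" if "N \<le> n" "x \<in> V N" for n x
      using that unfolding V_def by blast
  qed
qed

text \<open>For disjoint sets, each coordinate functional has absolute sum at most \<open>M\<close>
  over their indicators. If every set had one of the first \<open>L\<close> coordinates above
  \<open>e\<close>, then \<open>k * e \<le> L * M\<close> for all \<open>k\<close>.\<close>

lemma nonnull01_small_coord:
  assumes W: "nonnull01 W" and e: "0 < e"
  obtains W' where "W' \<subseteq> W" "nonnull01 W'" "\<And>n. n < L \<Longrightarrow> \<bar>coord (ind01 W') n\<bar> \<le> e"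
proof -
  obtain A :: "nat \<Rightarrow> real set"
    where A: "disjoint_family A" "\<And>i. A i \<subseteq> W" "\<And>i. nonnull01 (A i)"
    using nonnull01_disjoint_seq[OF W] by blast
  have Am: "A i \<in> sets leb01" for i using A(3) by (simp add: nonnull01_def)
  have row: "(\<Sum>i<k. \<bar>coord (ind01 (A i)) n\<bar>) \<le> M" for k n
  proof -
    \<comment> \<open>Signs that make all terms of the coordinate add up; disjointness keeps the
      norm of \<open>f\<close> at most 1.\<close>
    define s where "s i = sgn (coord (ind01 (A i)) n)" for i
    define f where "f = (\<Sum>i<k. s i *\<^sub>R ind01 (A i))"
    have "AE x in leb01. \<forall>i. rep_linf01 (ind01 (A i)) x = indicator (A i) x"
      unfolding AE_all_countable using rep_ind01[OF Am] by blast
    with rep_linf01_sum[OF finite_lessThan[of k], of s "\<lambda>i. ind01 (A i)", folded f_def]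
    have "AE x in leb01. \<bar>rep_linf01 f x\<bar> \<le> 1"
    proof eventually_elim
      case (elim x)
      have "\<bar>rep_linf01 f x\<bar> \<le> (\<Sum>i<k. \<bar>s i * indicator (A i) x\<bar>)"
        unfolding elim(1) using elim(2) by (simp only: sum_abs)
      also have "\<dots> \<le> (\<Sum>i<k. indicator (A i) x)"
        by (rule sum_mono) (auto simp: s_def sgn_real_def indicator_def)
      also have "\<dots> = indicator (\<Union>i<k. A i) x"
        using A(1) by (subst indicator_UN_disjoint) (auto simp: disjoint_family_on_def)
      also have "\<dots> \<le> 1" by (auto simp: indicator_def)
      finally show ?case .
    qed
    then have "norm f \<le> 1" by (simp add: norm_linf01_le_iff)
    then have "\<bar>coord f n\<bar> \<le> M" by (rule coord_le_M)
    moreover have "coord f n = (\<Sum>i<k. \<bar>coord (ind01 (A i)) n\<bar>)"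
      unfolding f_def coord_sum by (rule sum.cong) (auto simp: s_def sgn_real_def)
    ultimately show ?thesis by linarith
  qed
  have "\<exists>i. \<forall>n<L. \<bar>coord (ind01 (A i)) n\<bar> \<le> e"
  proof (rule ccontr)
    assume "\<nexists>i. \<forall>n<L. \<bar>coord (ind01 (A i)) n\<bar> \<le> e"
    then have big: "e \<le> (\<Sum>n<L. \<bar>coord (ind01 (A i)) n\<bar>)" for i
    proof -
      obtain n where n: "n < L" "e < \<bar>coord (ind01 (A i)) n\<bar>"
        using \<open>\<nexists>i. \<forall>n<L. \<bar>coord (ind01 (A i)) n\<bar> \<le> e\<close> by (meson linorder_not_le)
      have "\<bar>coord (ind01 (A i)) n\<bar> \<le> (\<Sum>n<L. \<bar>coord (ind01 (A i)) n\<bar>)"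
        by (rule member_le_sum) (use n in auto)
      with n show ?thesis by linarith
    qed
    obtain k :: nat where k: "L * M < k * e" using reals_Archimedean3[OF e] by blast
    have "k * e \<le> (\<Sum>i<k. \<Sum>n<L. \<bar>coord (ind01 (A i)) n\<bar>)"
      using sum_mono[of "{..<k}" "\<lambda>_. e", OF big] by simp
    also have "\<dots> = (\<Sum>n<L. \<Sum>i<k. \<bar>coord (ind01 (A i)) n\<bar>)" by (rule sum.swap)
    also have "\<dots> \<le> L * M" using sum_mono[of "{..<L}" _ "\<lambda>_. M", OF row] by simp
    finally show False using k by simp
  qed
  with that A show thesis by blast
qed

text \<open>
  Only the indices \<open>n\<close> for which \<open>s n * g n\<close> has the sign \<open>t\<close> at the point considered enter the
  estimate; all others are absorbed in the remainder, so no cancellation can occur.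
\<close>

lemma flip_norm_lower:
  fixes s \<alpha> :: "nat \<Rightarrow> real"
  assumes J: "finite J" and \<alpha>: "\<And>n. n \<in> J \<Longrightarrow> 0 \<le> \<alpha> n" and s: "\<And>n. n \<in> J \<Longrightarrow> s n \<in> {1, -1}"
    and W: "nonnull01 W" and t: "t \<in> {1, -1::real}"
    and tight: "\<And>x. x \<in> W \<Longrightarrow> 1 - d < t * rep_linf01 (\<Sum>n\<in>J. (\<alpha> n * s n) *\<^sub>R g n) x"
    and G: "AE x in leb01. x \<in> W \<longrightarrow> rep_linf01 G x = - (2 - d) * t"
    and Y: "Y \<le> norm (T G) + \<eta>" and \<eta>: "0 \<le> \<eta>" and c: "0 \<le> c"
    and D: "(\<Sum>n\<in>J. max 0 (c * \<alpha> n - s n * coord G n - Y)) \<le> D"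
  shows "2 - d + c * (1 - d) - D - \<eta> \<le> norm (T G)"
proof -
  define X where "X = norm (T G)"
  \<comment> \<open>The index set used below depends on the point \<open>x\<close>, so the bounds
    are first secured for all subsets of \<open>J\<close> at once.\<close>
  have "AE x in leb01. \<forall>K\<in>Pow J. \<bar>rep_linf01 G x - (\<Sum>n\<in>K. coord G n * rep_linf01 (g n) x)\<bar>
    \<le> (1 - (\<Sum>n\<in>K. \<bar>rep_linf01 (g n) x\<bar>)) * X"
    using Q_remainder_AE[of _ "T G" X] J ell_inf_apply_le[of "T G"]
    by (intro AE_finite_allI) (auto simp: QT X_def dest: finite_subset)
  moreover have "AE x in leb01. \<forall>K\<in>Pow J. (\<Sum>n\<in>K. \<bar>rep_linf01 (g n) x\<bar>) \<le> 1"
    using sum_abs_g_le_AE J by (intro AE_finite_allI) (auto dest: finite_subset)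
  moreover note rep_linf01_sum[OF J, of "\<lambda>n. \<alpha> n * s n" g] G
  ultimately have ae: "AE x in leb01.
      (\<forall>K\<in>Pow J. \<bar>rep_linf01 G x - (\<Sum>n\<in>K. coord G n * rep_linf01 (g n) x)\<bar>
        \<le> (1 - (\<Sum>n\<in>K. \<bar>rep_linf01 (g n) x\<bar>)) * X) \<and>
      (\<forall>K\<in>Pow J. (\<Sum>n\<in>K. \<bar>rep_linf01 (g n) x\<bar>) \<le> 1) \<and>
      rep_linf01 (\<Sum>n\<in>J. (\<alpha> n * s n) *\<^sub>R g n) x = (\<Sum>n\<in>J. (\<alpha> n * s n) * rep_linf01 (g n) x) \<and>
      (x \<in> W \<longrightarrow> rep_linf01 G x = - (2 - d) * t)" (is "AE x in leb01. ?P x")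
    by eventually_elim blast
  obtain x where x: "x \<in> W" and Px: "?P x" by (rule nonnull01_AE_obtain[OF W ae])
  have Sx: "rep_linf01 (\<Sum>n\<in>J. (\<alpha> n * s n) *\<^sub>R g n) x = (\<Sum>n\<in>J. (\<alpha> n * s n) * rep_linf01 (g n) x)"
    and Gx: "rep_linf01 G x = - (2 - d) * t"
    using Px x by auto
  note rem = Px[THEN conjunct1, rule_format, OF PowI]
    and le1 = Px[THEN conjunct2, THEN conjunct1, rule_format, OF PowI]
  define \<gamma> where "\<gamma> n = rep_linf01 (g n) x" for n
  define K where "K = {n \<in> J. 0 < t * s n * \<gamma> n}"
  have KJ: "K \<subseteq> J" and fK: "finite K" using J by (auto simp: K_def)
  have tg: "t * \<gamma> n = s n * \<bar>\<gamma> n\<bar>" if "n \<in> K" for n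
    using that s[of n] t by (auto simp: K_def)
  have "1 - d < (\<Sum>n\<in>J. \<alpha> n * (t * s n * \<gamma> n))"
    using tight[OF x] unfolding Sx \<gamma>_def by (simp add: sum_distrib_left mult_ac)
  also have "\<dots> \<le> (\<Sum>n\<in>J. if n \<in> K then \<alpha> n * \<bar>\<gamma> n\<bar> else 0)"
  proof (rule sum_mono)
    fix n assume n: "n \<in> J"
    show "\<alpha> n * (t * s n * \<gamma> n) \<le> (if n \<in> K then \<alpha> n * \<bar>\<gamma> n\<bar> else 0)"
    proof (cases "n \<in> K")
      case True
      then show ?thesis using s[OF n] tg[OF True] by auto
    next
      case False
      then have "t * s n * \<gamma> n \<le> 0" using n by (auto simp: K_def)
      then show ?thesis using False \<alpha>[OF n] by (simp add: mult_nonneg_nonpos)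
    qed
  qed
  also have "\<dots> = (\<Sum>n\<in>K. \<alpha> n * \<bar>\<gamma> n\<bar>)"
    using J KJ by (simp add: sum.If_cases Int_absorb1)
  finally have wt: "1 - d \<le> (\<Sum>n\<in>K. \<alpha> n * \<bar>\<gamma> n\<bar>)" by simp
  \<comment> \<open>The deficiency of index \<open>n\<close>; since
    \<open>\<bar>\<gamma> n\<bar> \<le> 1\<close> it can be charged in full, without its
    weight.\<close>
  define dn where "dn n = max 0 (c * \<alpha> n - s n * coord G n - Y)" for n
  have ineq: "c * (\<alpha> n * \<bar>\<gamma> n\<bar>) - dn n - \<eta> * \<bar>\<gamma> n\<bar> \<le> \<bar>\<gamma> n\<bar> * (s n * coord G n + X)" if n: "n \<in> K" for n
  proof -
    have "\<bar>\<gamma> n\<bar> \<le> (\<Sum>n\<in>K. \<bar>\<gamma> n\<bar>)" by (rule member_le_sum) (use n fK in auto)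
    then have g1: "\<bar>\<gamma> n\<bar> \<le> 1" using le1[OF KJ] by (simp add: \<gamma>_def)
    have "c * \<alpha> n - dn n - \<eta> \<le> s n * coord G n + X" using Y by (simp add: dn_def X_def)
    then have "\<bar>\<gamma> n\<bar> * (c * \<alpha> n - dn n - \<eta>) \<le> \<bar>\<gamma> n\<bar> * (s n * coord G n + X)"
      by (rule mult_left_mono) simp
    moreover have "\<bar>\<gamma> n\<bar> * dn n \<le> 1 * dn n"
      by (rule mult_right_mono[OF g1]) (simp add: dn_def)
    ultimately show ?thesis by (simp add: algebra_simps)
  qed
  \<comment> \<open>Multiplication by \<open>- t\<close> turns the value of \<open>G\<close> at
    \<open>x\<close> into \<open>2 - d\<close>, as \<open>t\<close> squares to 1.\<close>
  have "(2 - d) + (\<Sum>n\<in>K. coord G n * (t * \<gamma> n)) = - t * (rep_linf01 G x - (\<Sum>n\<in>K. coord G n * \<gamma> n))"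
    using t unfolding Gx by (auto simp: sum_distrib_left sum_negf algebra_simps)
  also have "\<dots> \<le> (1 - (\<Sum>n\<in>K. \<bar>\<gamma> n\<bar>)) * X"
    using rem[OF KJ] t by (auto simp: \<gamma>_def)
  finally have "(2 - d) + (\<Sum>n\<in>K. coord G n * (t * \<gamma> n)) \<le> (1 - (\<Sum>n\<in>K. \<bar>\<gamma> n\<bar>)) * X" .
  moreover have "(\<Sum>n\<in>K. coord G n * (t * \<gamma> n)) = (\<Sum>n\<in>K. \<bar>\<gamma> n\<bar> * (s n * coord G n))"
    by (rule sum.cong) (auto simp: tg)
  ultimately have "(2 - d) + (\<Sum>n\<in>K. \<bar>\<gamma> n\<bar> * (s n * coord G n + X)) \<le> X"
    by (simp add: algebra_simps sum.distrib sum_distrib_left)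
  moreover have "(\<Sum>n\<in>K. c * (\<alpha> n * \<bar>\<gamma> n\<bar>) - dn n - \<eta> * \<bar>\<gamma> n\<bar>) \<le> (\<Sum>n\<in>K. \<bar>\<gamma> n\<bar> * (s n * coord G n + X))"
    by (rule sum_mono) (rule ineq)
  moreover have "(\<Sum>n\<in>K. c * (\<alpha> n * \<bar>\<gamma> n\<bar>) - dn n - \<eta> * \<bar>\<gamma> n\<bar>)
      = c * (\<Sum>n\<in>K. \<alpha> n * \<bar>\<gamma> n\<bar>) - (\<Sum>n\<in>K. dn n) - \<eta> * (\<Sum>n\<in>K. \<bar>\<gamma> n\<bar>)"
    by (simp add: sum_subtractf sum_distrib_left)
  moreover have "\<eta> * (\<Sum>n\<in>K. \<bar>\<gamma> n\<bar>) \<le> \<eta> * 1"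
    using le1[OF KJ] \<eta> by (intro mult_left_mono) (simp_all add: \<gamma>_def)
  moreover have "(\<Sum>n\<in>K. dn n) \<le> (\<Sum>n\<in>J. dn n)"
    by (rule sum_mono2[OF J KJ]) (simp add: dn_def)
  moreover have "(\<Sum>n\<in>J. dn n) \<le> D" using D by (simp add: dn_def)
  moreover have "c * (1 - d) \<le> c * (\<Sum>n\<in>K. \<alpha> n * \<bar>\<gamma> n\<bar>)" by (rule mult_left_mono[OF wt c])
  ultimately show ?thesis unfolding X_def by linarith
qed

section \<open>Configurations, their start at level 0 and their growth\<close>

abbreviation comb :: "nat set \<Rightarrow> (nat \<Rightarrow> real) \<Rightarrow> (nat \<Rightarrow> real) \<Rightarrow> linf01"
  where "comb J \<alpha> s \<equiv> \<Sum>n\<in>J. (\<alpha> n * s n) *\<^sub>R g n"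

text \<open>
  The last clause says that, up to a small total deficiency, \<open>\<alpha> n \<le> M - w\<close> whenever the \<open>n\<close>-th
  coordinate of \<open>T F\<close> has attained \<open>w\<close>. Each step contracts the deficiency by a factor \<open>99 / 100\<close>, so
  indices recorded at a lower level do not accumulate.
\<close>

definition config ::
    "real \<Rightarrow> linf01 \<Rightarrow> nat set \<Rightarrow> (nat \<Rightarrow> real) \<Rightarrow> (nat \<Rightarrow> real) \<Rightarrow> nat \<Rightarrow> bool"
  where "config w F J \<alpha> s N \<longleftrightarrow>
    finite J \<and> 0 \<le> w \<and> w \<le> M - 1 \<and> (\<forall>n\<in>J. 0 \<le> \<alpha> n) \<and> (\<forall>n\<in>J. s n \<in> {1, -1}) \<and>
    norm (F + comb J \<alpha> s) \<le> 1 \<and>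
    \<not> (AE x in leb01. rep_linf01 F x = 0 \<longrightarrow> \<bar>rep_linf01 (comb J \<alpha> s) x\<bar> \<le> 1 - 1 / 1000) \<and>
    (\<forall>n\<ge>N. AE x in leb01. rep_linf01 F x \<noteq> 0 \<longrightarrow> \<bar>rep_linf01 (g n) x\<bar> \<le> 1 / 1000) \<and>
    norm (T F) \<le> w \<and> (\<exists>n. w - 1 / 10 ^ 7 \<le> \<bar>coord F n\<bar>) \<and>
    (\<Sum>n\<in>J. \<alpha> n) \<le> 750 \<and>
    (\<Sum>n\<in>J. max 0 (2 * w / (M - w) * \<alpha> n - s n * coord F n - w)) \<le> 1 / 1000"

lemma coord_comb:
  "finite J \<Longrightarrow> coord (comb J \<alpha> s) n = (if n \<in> J then \<alpha> n * s n else 0)"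
  by (simp add: coord_sum coord_g if_distrib cong: if_cong)

text \<open>With \<open>F = 0\<close> the tail clause is vacuous, and at level 0 the deficiency
  vanishes. The coefficient normalises \<open>g 0\<close> and is at most \<open>M\<close>.\<close>

lemma config_0:
  assumes M: "M \<le> 15 / 2"
  shows "config 0 0 {0} (\<lambda>_. 1 / norm (g 0)) (\<lambda>_. 1) 0"
proof -
  have "1 \<le> M * norm (g 0)" using coord_le[of "g 0" 0] by (simp add: coord_g)
  then have pos: "0 < norm (g 0)" using M_ge_1
    by (metis mult_zero_right not_one_le_zero zero_less_norm_iff norm_zero)
  have \<alpha>: "1 / norm (g 0) \<le> M" using \<open>1 \<le> M * norm (g 0)\<close> pos by (simp add: divide_le_eq)
  have T0: "T 0 = 0" by (rule linear_0[OF linear_T])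
  have tight: "\<not> (AE x in leb01. rep_linf01 0 x = 0 \<longrightarrow>
      \<bar>rep_linf01 ((1 / norm (g 0)) *\<^sub>R g 0) x\<bar> \<le> 1 - 1 / 1000)"
  proof
    assume "AE x in leb01. rep_linf01 0 x = 0 \<longrightarrow> \<bar>rep_linf01 ((1 / norm (g 0)) *\<^sub>R g 0) x\<bar> \<le> 1 - 1 / 1000"
    with rep_linf01_zero have "AE x in leb01. \<bar>rep_linf01 ((1 / norm (g 0)) *\<^sub>R g 0) x\<bar> \<le> 1 - 1 / 1000"
      by eventually_elim simp
    then have "norm ((1 / norm (g 0)) *\<^sub>R g 0) \<le> 1 - 1 / 1000" by (simp only: norm_linf01_le_iff)
    then show False using pos by simp
  qed
  have nice: "AE x in leb01. rep_linf01 0 x \<noteq> 0 \<longrightarrow> \<bar>rep_linf01 (g n) x\<bar> \<le> 1 / 1000" for n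
    using rep_linf01_zero by eventually_elim simp
  show ?thesis
    unfolding config_def using pos \<alpha> tight nice M M_ge_1 by (simp add: T0)
qed

text \<open>By the arithmetic-geometric mean inequality \<open>w * (M - w)\<close> is at most
  \<open>M ^ 2 / 4\<close>, hence at most \<open>15 / 8 * M\<close>; the remaining
  \<open>1 / 8 * M\<close> up to \<open>2 * M\<close> pays for the gap.\<close>

lemma growth_gap:
  assumes "M \<le> 15 / 2" "0 \<le> w" "w \<le> M - 1"
  shows "w + 1 / 8 \<le> 2 + 2 * w / (M - w)"
proof -
  have "w * (M - w) \<le> (M / 2) ^ 2"
    using zero_le_power2[of "w - M / 2"] by (simp add: power2_eq_square field_simps)
  also have "\<dots> \<le> 15 / 8 * M"
    using mult_right_mono[of M "15 / 2" M] assms M_ge_1 by (simp add: power2_eq_square)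
  finally have "w * (M - w) + 1 / 8 * (M - w) \<le> 15 / 8 * M + 1 / 8 * M"
    by (rule add_mono) (use assms in simp)
  then have "(w + 1 / 8) * (M - w) \<le> 2 * M" by (simp add: distrib_right)
  moreover have "2 + 2 * w / (M - w) = 2 * M / (M - w)" using assms by (simp add: field_simps)
  ultimately show ?thesis using assms by (simp add: pos_le_divide_eq)
qed

text \<open>The flip gains at least \<open>1 / 10\<close>, but the level rises only by
  \<open>1 / 10 ^ 9\<close>. The surplus makes the rescaling factor \<kappa> at most
  \<open>99 / 100\<close>, which contracts old deficiencies, while the coefficient \<open>c\<close>
  hardly changes.\<close>

lemma config_step:
  assumes M: "M \<le> 15 / 2" and cfg: "config w F J \<alpha> s N"
  shows "\<exists>F J \<alpha> s N. config (w + 1 / 10 ^ 9) F J \<alpha> s N"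
proof -
  define P where "P = comb J \<alpha> s"
  define c where "c = 2 * w / (M - w)"
  have J: "finite J" and w0: "0 \<le> w" and wM: "w \<le> M - 1"
    and \<alpha>0: "\<And>n. n \<in> J \<Longrightarrow> 0 \<le> \<alpha> n" and s1: "\<And>n. n \<in> J \<Longrightarrow> s n \<in> {1, -1}"
    and FP: "norm (F + P) \<le> 1"
    and tight: "\<not> (AE x in leb01. rep_linf01 F x = 0 \<longrightarrow> \<bar>rep_linf01 P x\<bar> \<le> 1 - 1 / 1000)"
    and nice: "\<And>n. N \<le> n \<Longrightarrow> AE x in leb01. rep_linf01 F x \<noteq> 0 \<longrightarrow> \<bar>rep_linf01 (g n) x\<bar> \<le> 1 / 1000"
    and TF: "norm (T F) \<le> w" and n0: "\<exists>n. w - 1 / 10 ^ 7 \<le> \<bar>coord F n\<bar>"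
    and \<alpha>sum: "(\<Sum>n\<in>J. \<alpha> n) \<le> 750"
    and D: "(\<Sum>n\<in>J. max 0 (c * \<alpha> n - s n * coord F n - w)) \<le> 1 / 1000"
    using cfg unfolding config_def P_def[symmetric] c_def[symmetric] by auto
  have c0: "0 \<le> c" using w0 wM by (simp add: c_def)
  \<comment> \<open>From \<open>w \<le> M - 1 \<le> 13 / 2\<close> and
    \<open>M - w \<ge> 1\<close>.\<close>
  have c13: "c \<le> 13"
  proof -
    have "2 * w \<le> 13" using wM M by linarith
    also have "\<dots> \<le> 13 * (M - w)" using wM by simp
    finally show ?thesis using wM by (simp add: c_def divide_le_eq)
  qed

  obtain t :: real and W0 where t: "t \<in> {1, -1}" and W0: "nonnull01 W0"
    and W0F: "\<And>x. x \<in> W0 \<Longrightarrow> rep_linf01 F x = 0"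
    and W0P: "\<And>x. x \<in> W0 \<Longrightarrow> 1 - 1 / 1000 < t * rep_linf01 P x"
  proof -
    define A where "A t = {x \<in> space leb01. rep_linf01 F x = 0 \<and> 1 - 1 / 1000 < t * rep_linf01 P x}" for t :: real
    have Am: "A t \<in> sets leb01" for t unfolding A_def by measurable
    have "nonnull01 (A 1) \<or> nonnull01 (A (-1))"
    proof (rule ccontr)
      assume "\<not> (nonnull01 (A 1) \<or> nonnull01 (A (-1)))"
      then have "AE x in leb01. x \<notin> A 1" "AE x in leb01. x \<notin> A (-1)"
        using Am by (auto simp: nonnull01_def)
      then have "AE x in leb01. rep_linf01 F x = 0 \<longrightarrow> \<bar>rep_linf01 P x\<bar> \<le> 1 - 1 / 1000"
        using AE_space
      proof eventually_elim
        case (elim x)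
        then show ?case unfolding A_def by (simp add: abs_le_iff) linarith
      qed
      with tight show False by contradiction
    qed
    then show thesis
    proof
      assume "nonnull01 (A 1)"
      show thesis by (rule that[OF _ \<open>nonnull01 (A 1)\<close>, of 1]) (simp_all add: A_def)
    next
      assume "nonnull01 (A (-1))"
      show thesis by (rule that[OF _ \<open>nonnull01 (A (-1))\<close>, of "-1"]) (simp_all add: A_def)
    qed
  qed
  obtain W1 N1 where W1: "W1 \<subseteq> W0" "nonnull01 W1"
    and W1g: "\<And>n x. N1 \<le> n \<Longrightarrow> x \<in> W1 \<Longrightarrow> \<bar>rep_linf01 (g n) x\<bar> \<le> 1 / 1000"
    by (rule nonnull01_small_tail[OF W0, of "1 / 1000"]) auto
  obtain n0 where n0: "w - 1 / 10 ^ 7 \<le> \<bar>coord F n0\<bar>" using n0 by blast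
  obtain k0 where k0: "J \<subseteq> {..<k0}" using finite_nat_bounded[OF J] by blast
  \<comment> \<open>\<open>L\<close> lies beyond the index attaining the level, all of
    \<open>J\<close> and both tail thresholds: below \<open>L\<close> the flip is almost invisible,
    and from \<open>L\<close> on \<open>g n\<close> is small wherever \<open>F\<close> or the flip
    lives.\<close>
  define L where "L = Suc n0 + k0 + N + N1"
  have JL: "n < L" if "n \<in> J" for n using k0 that by (auto simp: L_def)
  \<comment> \<open>The division by \<open>card J + 1\<close> keeps the total error over
    \<open>J\<close> below \<open>1 / 10 ^ 8\<close>, however large \<open>J\<close> is.\<close>
  define e where "e = 1 / (10 ^ 8 * (real (card J) + 1))"
  have e0: "0 < e" by (simp add: e_def)
  have e8: "e \<le> 1 / 10 ^ 8" and ecard: "real (card J) * e \<le> 1 / 10 ^ 8"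
    by (simp_all add: e_def field_simps)
  obtain W where W: "W \<subseteq> W1" "nonnull01 W" and We: "\<And>n. n < L \<Longrightarrow> \<bar>coord (ind01 W) n\<bar> \<le> e"
    by (rule nonnull01_small_coord[OF W1(2) e0, of L]) auto
  have WF: "rep_linf01 F x = 0" and WP: "1 - 1 / 1000 < t * rep_linf01 P x" if "x \<in> W" for x
    using W0F W0P W W1 that by auto

  \<comment> \<open>On \<open>W\<close> the value of \<open>t * P\<close> lies between
    \<open>999 / 1000\<close> and 1; subtracting \<open>2 - 1 / 1000\<close> lands between -1 and
    \<open>- 999 / 1000\<close>, so \<open>G + P\<close> still has norm at most 1.\<close>
  define G where "G = F + (- (2 - 1 / 1000) * t) *\<^sub>R ind01 W"
  have W_sets: "W \<in> sets leb01" using W(2) by (simp add: nonnull01_def)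
  have repG: "AE x in leb01. rep_linf01 G x = rep_linf01 F x - (2 - 1 / 1000) * t * indicator W x"
    using rep_linf01_add[of F "(- (2 - 1 / 1000) * t) *\<^sub>R ind01 W"]
      rep_linf01_scaleR[of "- (2 - 1 / 1000) * t" "ind01 W"] rep_ind01[OF W_sets]
    unfolding G_def by eventually_elim simp
  have coordG: "\<bar>coord G n - coord F n\<bar> \<le> 2 * e" if "n < L" for n
  proof -
    have "coord G n - coord F n = - (2 - 1 / 1000) * t * coord (ind01 W) n"
      unfolding G_def coord_add coord_scaleR by simp
    then have "\<bar>coord G n - coord F n\<bar> = (2 - 1 / 1000) * \<bar>coord (ind01 W) n\<bar>"
      using t by (auto simp: abs_mult)
    also have "\<dots> \<le> 2 * e" using We[OF that] by simp
    finally show ?thesis .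
  qed
  define X where "X = norm (T G)"
  have coord_le_X: "\<bar>coord G n\<bar> \<le> X" for n unfolding X_def by (rule ell_inf_apply_le)
  have wX: "w \<le> X + 12 / 10 ^ 8"
    using n0 coordG[of n0] coord_le_X[of n0] e8 by (simp add: L_def)
  have DG: "(\<Sum>n\<in>J. max 0 (c * \<alpha> n - s n * coord G n - w)) \<le> 1 / 1000 + 2 / 10 ^ 8"
  proof -
    have "(\<Sum>n\<in>J. max 0 (c * \<alpha> n - s n * coord G n - w))
      \<le> (\<Sum>n\<in>J. max 0 (c * \<alpha> n - s n * coord F n - w) + 2 * e)"
    proof (rule sum_mono)
      fix n assume n: "n \<in> J"
      show "max 0 (c * \<alpha> n - s n * coord G n - w) \<le> max 0 (c * \<alpha> n - s n * coord F n - w) + 2 * e"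
        using coordG[OF JL[OF n]] s1[OF n] e0 by auto
    qed
    also have "\<dots> = (\<Sum>n\<in>J. max 0 (c * \<alpha> n - s n * coord F n - w)) + 2 * (real (card J) * e)"
      by (simp add: sum.distrib)
    finally show ?thesis using D ecard by linarith
  qed
  \<comment> \<open>The loss is \<open>1 / 1000\<close> from the flip height, at most
    \<open>13 / 1000\<close> from \<open>c\<close>, \<open>1 / 1000\<close> from the deficiency, and
    a negligible rest.\<close>
  have X_lower: "2 + c - 151 / 10000 \<le> X"
  proof -
    have "2 - 1 / 1000 + c * (1 - 1 / 1000) - (1 / 1000 + 2 / 10 ^ 8) - 12 / 10 ^ 8 \<le> norm (T G)"
    proof (rule flip_norm_lower[OF J _ _ W(2) t])
      show "AE x in leb01. x \<in> W \<longrightarrow> rep_linf01 G x = - (2 - 1 / 1000) * t"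
        using repG by eventually_elim (simp add: WF)
    qed (use \<alpha>0 s1 WP wX c0 DG in \<open>auto simp: P_def X_def\<close>)
    then show ?thesis using c13 unfolding X_def by simp
  qed
  have X_gap: "w + 1 / 10 \<le> X"
    using X_lower growth_gap[OF M w0 wM] unfolding c_def by linarith

  define u where "u = G + P"
  have repFP: "AE x in leb01. \<bar>rep_linf01 F x + rep_linf01 P x\<bar> \<le> 1"
    using FP[unfolded norm_linf01_le_iff] rep_linf01_add[of F P] by eventually_elim simp
  have u1: "norm u \<le> 1"
    unfolding norm_linf01_le_iff using repFP repG rep_linf01_add[of G P, folded u_def]
  proof eventually_elim
    case (elim x)
    show ?case
    proof (cases "x \<in> W")
      case True
      with elim WF[OF True] WP[OF True] t show ?thesis by auto
    next
      case False
      with elim show ?thesis by simp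
    qed
  qed
  have coord_u: "coord u n = coord G n + (if n \<in> J then \<alpha> n * s n else 0)" for n
    unfolding u_def P_def coord_add coord_comb[OF J] ..
  obtain m where m: "X - 1 / 10 ^ 7 < \<bar>coord G m\<bar>"
    by (rule ell_inf_norm_less_obtain[of "X - 1 / 10 ^ 7" "T G"]) (auto simp: X_def)
  \<comment> \<open>Below \<open>L\<close> the coordinates of \<open>G\<close> stay close to those
    of \<open>F\<close>, which are at most \<open>w\<close>, too small for \<open>m\<close>.\<close>
  have mL: "L \<le> m"
  proof (rule ccontr)
    assume "\<not> L \<le> m"
    then have "\<bar>coord G m - coord F m\<bar> \<le> 2 * e" by (simp add: coordG)
    moreover have "\<bar>coord F m\<bar> \<le> w" using ell_inf_apply_le[of "T F" m] TF by linarith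
    ultimately show False using m X_gap e8 by simp
  qed
  have mJ: "m \<notin> J" using JL mL by force
  have Gm_M: "\<bar>coord G m\<bar> \<le> M" using coord_le_M[OF u1, of m] mJ by (simp add: coord_u)
  have X_M: "X \<le> M + 1 / 10 ^ 7" using m Gm_M by linarith

  \<comment> \<open>A smaller \<open>M - w\<close> would force \<open>X\<close>, about
    \<open>2 * M / (M - w)\<close>, above \<open>M\<close>. This leaves room for the next level
    under \<open>M - 1\<close>.\<close>
  have Mw: "19 / 10 \<le> M - w"
  proof (rule ccontr)
    assume neg: "\<not> 19 / 10 \<le> M - w"
    have "2 + c = 2 * M / (M - w)" using wM by (simp add: c_def field_simps)
    then have "2 * M / (M - w) \<le> M + 16 / 1000" using X_lower X_M by simp
    then have "2 * M \<le> (M + 16 / 1000) * (M - w)" using wM by (simp add: pos_divide_le_eq)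
    also have "\<dots> \<le> (M + 16 / 1000) * (19 / 10)" using neg M_ge_1 by (intro mult_left_mono) auto
    finally show False using M_ge_1 by simp
  qed
  define w' where "w' = w + 1 / 10 ^ 9"
  define c' where "c' = 2 * w' / (M - w')"
  have Mw': "1 \<le> M - w'" using Mw by (simp add: w'_def)
  have w'0: "0 < w'" using w0 by (simp add: w'_def)
  have c'0: "0 \<le> c'" using w'0 Mw' by (simp add: c'_def)
  have c'13: "c' \<le> 13"
  proof -
    have "2 * w' \<le> 13" using Mw' M by linarith
    also have "\<dots> \<le> 13 * (M - w')" using Mw' by simp
    finally show ?thesis using Mw' by (simp add: c'_def divide_le_eq)
  qed
  have c'c: "c' \<le> c + 8 / 10 ^ 9"
  proof -
    have "c' - c = 2 * M * (w' - w) / ((M - w') * (M - w))"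
      using Mw Mw' by (simp add: c_def c'_def field_simps)
    also have "\<dots> \<le> 2 * M * (w' - w) / (1 * (19 / 10))"
      using Mw Mw' M_ge_1 by (intro divide_left_mono mult_mono) (auto simp: w'_def)
    also have "\<dots> \<le> 8 / 10 ^ 9" using M by (simp add: w'_def)
    finally show ?thesis by linarith
  qed
  define \<kappa> where "\<kappa> = w' / X"
  have Xpos: "0 < X" using X_gap w0 by linarith
  have \<kappa>X: "\<kappa> * X = w'" using Xpos by (simp add: \<kappa>_def)
  have \<kappa>0: "0 \<le> \<kappa>" using w'0 Xpos by (simp add: \<kappa>_def)
  have \<kappa>1: "\<kappa> \<le> 99 / 100"
  proof -
    have "X \<le> 8" using X_M M by simp
    then have "w' \<le> 99 / 100 * X" using X_gap by (simp add: w'_def)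
    then show ?thesis using Xpos by (simp add: \<kappa>_def pos_divide_le_eq)
  qed
  have \<kappa>m: "w' - 1 / 10 ^ 7 \<le> \<kappa> * \<bar>coord G m\<bar>"
  proof -
    have "\<kappa> * (X - 1 / 10 ^ 7) \<le> \<kappa> * \<bar>coord G m\<bar>" using m \<kappa>0 by (intro mult_left_mono) auto
    then show ?thesis using \<kappa>X \<kappa>1 by (simp add: right_diff_distrib)
  qed

  define \<sigma> :: real where "\<sigma> = (if 0 \<le> coord G m then 1 else -1)"
  have \<sigma>: "\<sigma> \<in> {1, -1}" "\<sigma> * coord G m = \<bar>coord G m\<bar>" by (auto simp: \<sigma>_def)
  \<comment> \<open>\<open>g m\<close> raises the \<open>m\<close>-th coordinate, already near
    \<open>w'\<close> in absolute value, by exactly \<open>b\<close>; as this coordinate is bounded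
    by \<open>M\<close>, so is the choice of \<open>b\<close>.\<close>
  define v where "v b = \<kappa> *\<^sub>R u + (b * \<sigma>) *\<^sub>R g m" for b
  have v_coord: "\<kappa> * \<bar>coord G m\<bar> + b \<le> M" if "norm (v b) \<le> 1" for b
  proof -
    have "\<sigma> * coord (v b) m = \<kappa> * (\<sigma> * coord G m) + b"
      using mJ \<sigma>(1) by (auto simp: v_def coord_add coord_scaleR coord_g coord_u)
    moreover have "\<sigma> * coord (v b) m \<le> M" using coord_le_M[OF that, of m] \<sigma>(1) by auto
    ultimately show ?thesis by (simp add: \<sigma>(2))
  qed
  \<comment> \<open>A passage from true to false on a grid of mesh \<open>1 / 1000\<close> replaces
    a maximal multiple of \<open>g m\<close>; this matches the tolerance in
    \<open>config\<close>.\<close>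
  define R where "R k \<longleftrightarrow> norm (v (real k / 1000)) \<le> 1" for k :: nat
  have R0: "R 0"
  proof -
    have "\<kappa> * norm u \<le> 1 * 1" using u1 \<kappa>0 \<kappa>1 by (intro mult_mono) auto
    then show ?thesis using \<kappa>0 by (simp add: R_def v_def)
  qed
  have "\<exists>k. \<not> R k"
  proof -
    obtain k :: nat where "1000 * M < real k" using reals_Archimedean2 by blast
    then have "M < real k / 1000" by simp
    moreover have "0 \<le> \<kappa> * \<bar>coord G m\<bar>" using \<kappa>0 by simp
    ultimately have "\<not> R k" using v_coord[of "real k / 1000"] unfolding R_def by linarith
    then show ?thesis ..
  qed
  then obtain k where k: "R k" "\<not> R (Suc k)" using R0 by (metis nat_induct)
  define b where "b = real k / 1000"
  have b0: "0 \<le> b" by (simp add: b_def)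
  have vb: "norm (v b) \<le> 1" using k(1) by (simp add: R_def b_def)
  have vb': "\<not> norm (v (b + 1 / 1000)) \<le> 1" using k(2) by (simp add: R_def b_def add_divide_distrib add.commute)
  have bM: "\<kappa> * \<bar>coord G m\<bar> + b \<le> M" by (rule v_coord[OF vb])
  have bM': "b \<le> M" using bM mult_nonneg_nonneg[OF \<kappa>0, of "\<bar>coord G m\<bar>"] by simp

  define F' where "F' = \<kappa> *\<^sub>R G"
  define \<alpha>' where "\<alpha>' = (\<lambda>n. if n = m then b else \<kappa> * \<alpha> n)"
  define s' where "s' = s(m := \<sigma>)"
  define P' where "P' = comb (insert m J) \<alpha>' s'"
  have P'_eq: "P' = \<kappa> *\<^sub>R P + (b * \<sigma>) *\<^sub>R g m"
  proof -
    have "comb J \<alpha>' s' = \<kappa> *\<^sub>R P"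
      unfolding P_def scaleR_sum_right by (rule sum.cong) (use mJ in \<open>auto simp: \<alpha>'_def s'_def\<close>)
    then show ?thesis using J mJ by (simp add: P'_def \<alpha>'_def s'_def)
  qed
  have F'P': "F' + P' = v b"
    by (simp add: F'_def P'_eq v_def u_def scaleR_add_right)
  have coord_F': "coord F' n = \<kappa> * coord G n" for n by (simp add: F'_def coord_scaleR)
  have repF': "AE x in leb01. rep_linf01 F' x = \<kappa> * rep_linf01 G x"
    unfolding F'_def by (rule rep_linf01_scaleR)
  have niceG: "AE x in leb01. rep_linf01 G x \<noteq> 0 \<longrightarrow> \<bar>rep_linf01 (g n) x\<bar> \<le> 1 / 1000" if n: "L \<le> n" for n
  proof -
    have "N \<le> n" "N1 \<le> n" using n by (simp_all add: L_def)
    from repG nice[OF \<open>N \<le> n\<close>] show ?thesis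
    proof eventually_elim
      case (elim x)
      show ?case
      proof (cases "x \<in> W")
        case True
        then show ?thesis using W1g[OF \<open>N1 \<le> n\<close>, of x] W(1) by auto
      next
        case False
        then show ?thesis using elim by simp
      qed
    qed
  qed
  have nice': "AE x in leb01. rep_linf01 F' x \<noteq> 0 \<longrightarrow> \<bar>rep_linf01 (g n) x\<bar> \<le> 1 / 1000" if "L \<le> n" for n
    using repF' niceG[OF that] by eventually_elim auto
  \<comment> \<open>Otherwise \<open>b + 1 / 1000\<close> would also be admissible: where
    \<open>G\<close> vanishes there is slack \<open>1 / 1000\<close>, and elsewhere
    \<open>g m\<close> is small while \<open>\<kappa> * u\<close> is at most
    \<open>99 / 100\<close>.\<close>
  have tight': "\<not> (AE x in leb01. rep_linf01 F' x = 0 \<longrightarrow> \<bar>rep_linf01 P' x\<bar> \<le> 1 - 1 / 1000)"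
  proof
    assume ae: "AE x in leb01. rep_linf01 F' x = 0 \<longrightarrow> \<bar>rep_linf01 P' x\<bar> \<le> 1 - 1 / 1000"
    define b1 where "b1 = b + 1 / 1000"
    have v1: "v b1 = F' + (P' + (1 / 1000 * \<sigma>) *\<^sub>R g m)"
      by (simp add: F'_def P'_eq v_def u_def b1_def algebra_simps)
    have gm: "AE x in leb01. \<bar>rep_linf01 (g m) x\<bar> \<le> 1"
      using norm_g_le[of m] by (simp add: norm_linf01_le_iff)
    have ur: "AE x in leb01. \<bar>rep_linf01 u x\<bar> \<le> 1" using u1 by (simp add: norm_linf01_le_iff)
    have r1: "AE x in leb01. rep_linf01 (v b1) x = \<kappa> * rep_linf01 u x + b1 * \<sigma> * rep_linf01 (g m) x"
      using rep_linf01_add[of "\<kappa> *\<^sub>R u" "(b1 * \<sigma>) *\<^sub>R g m"] rep_linf01_scaleR[of \<kappa> u]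
        rep_linf01_scaleR[of "b1 * \<sigma>" "g m"]
      unfolding v_def by eventually_elim simp
    have r2: "AE x in leb01. rep_linf01 (v b1) x
        = rep_linf01 F' x + (rep_linf01 P' x + 1 / 1000 * \<sigma> * rep_linf01 (g m) x)"
      using rep_linf01_add[of F' "P' + (1 / 1000 * \<sigma>) *\<^sub>R g m"] rep_linf01_add[of P' "(1 / 1000 * \<sigma>) *\<^sub>R g m"]
        rep_linf01_scaleR[of "1 / 1000 * \<sigma>" "g m"]
      unfolding v1 by eventually_elim simp
    have "norm (v b1) \<le> 1"
      unfolding norm_linf01_le_iff
      using ae gm ur r1 r2 repF' niceG[OF mL]
    proof eventually_elim
      case (elim x)
      show ?case
      proof (cases "rep_linf01 G x = 0")
        case True
        then have "rep_linf01 (v b1) x = rep_linf01 P' x + 1 / 1000 * \<sigma> * rep_linf01 (g m) x"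
          and "\<bar>rep_linf01 P' x\<bar> \<le> 1 - 1 / 1000"
          using elim by auto
        then show ?thesis using elim(2) \<sigma>(1) by auto
      next
        case False
        then have gs: "\<bar>rep_linf01 (g m) x\<bar> \<le> 1 / 1000" using elim by simp
        have "\<bar>\<kappa> * rep_linf01 u x\<bar> \<le> 99 / 100 * 1"
          unfolding abs_mult using \<kappa>0 \<kappa>1 elim(3) by (intro mult_mono) auto
        moreover have "\<bar>b1 * \<sigma> * rep_linf01 (g m) x\<bar> \<le> 8 * (1 / 1000)"
        proof -
          have "\<bar>b1 * \<sigma> * rep_linf01 (g m) x\<bar> = b1 * \<bar>rep_linf01 (g m) x\<bar>"
            using \<sigma>(1) b0 by (auto simp: b1_def abs_mult)
          also have "\<dots> \<le> 8 * (1 / 1000)"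
            using gs b0 bM' M by (intro mult_mono) (auto simp: b1_def)
          finally show ?thesis .
        qed
        ultimately show ?thesis unfolding elim(4) by linarith
      qed
    qed
    with vb' show False by (simp add: b1_def)
  qed
  have TF': "norm (T F') \<le> w'"
    using \<kappa>X \<kappa>0 by (simp add: F'_def linear_scale[OF linear_T] X_def)
  \<comment> \<open>750 is the fixed point of scaling by \<open>99 / 100\<close> and adding
    \<open>15 / 2\<close>, the bound on \<open>b\<close>.\<close>
  have sum': "(\<Sum>n\<in>insert m J. \<alpha>' n) \<le> 750"
  proof -
    have "(\<Sum>n\<in>insert m J. \<alpha>' n) = b + (\<Sum>n\<in>J. \<alpha>' n)" using J mJ by (simp add: \<alpha>'_def)
    also have "(\<Sum>n\<in>J. \<alpha>' n) = \<kappa> * (\<Sum>n\<in>J. \<alpha> n)"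
      unfolding sum_distrib_left by (rule sum.cong) (use mJ in \<open>auto simp: \<alpha>'_def\<close>)
    also have "\<kappa> * (\<Sum>n\<in>J. \<alpha> n) \<le> 99 / 100 * 750"
      using \<kappa>0 \<kappa>1 \<alpha>sum \<alpha>0 by (intro mult_mono) (auto intro: sum_nonneg)
    finally show ?thesis using bM' M by simp
  qed
  have D': "(\<Sum>n\<in>insert m J. max 0 (c' * \<alpha>' n - s' n * coord F' n - w')) \<le> 1 / 1000"
  proof -
    have "(\<Sum>n\<in>J. max 0 (c' * \<alpha>' n - s' n * coord F' n - w'))
      \<le> (\<Sum>n\<in>J. 99 / 100 * max 0 (c * \<alpha> n - s n * coord F n - w) + 8 / 10 ^ 9 * \<alpha> n + 2 * e)"
    proof (rule sum_mono)
      fix n assume n: "n \<in> J"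
      define q where "q = c * \<alpha> n - s n * coord F n - w"
      have nm: "n \<noteq> m" using n mJ by auto
      have a0: "0 \<le> \<alpha> n" by (rule \<alpha>0[OF n])
      have "c' * \<alpha>' n - s' n * coord F' n - w' = \<kappa> * (c' * \<alpha> n - s n * coord G n) - w'"
        using nm by (simp add: \<alpha>'_def s'_def coord_F' algebra_simps)
      \<comment> \<open>As \<open>\<kappa> * w \<le> w'\<close>, the factor \<kappa> can be taken
        out of the whole deficiency; this is the contraction.\<close>
      also have "\<dots> \<le> \<kappa> * (c' * \<alpha> n - s n * coord G n - w)"
      proof -
        have "\<kappa> * w \<le> 1 * w" using \<kappa>1 w0 by (intro mult_right_mono) auto
        then show ?thesis by (simp add: algebra_simps w'_def)
      qed
      also have "\<dots> \<le> \<kappa> * (q + 8 / 10 ^ 9 * \<alpha> n + 2 * e)"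
      proof (rule mult_left_mono[OF _ \<kappa>0])
        have "c' * \<alpha> n \<le> (c + 8 / 10 ^ 9) * \<alpha> n" by (rule mult_right_mono[OF c'c a0])
        moreover have "- (s n * coord G n) \<le> - (s n * coord F n) + 2 * e"
          using coordG[OF JL[OF n]] s1[OF n] by auto
        ultimately show "c' * \<alpha> n - s n * coord G n - w \<le> q + 8 / 10 ^ 9 * \<alpha> n + 2 * e"
          by (simp add: q_def algebra_simps)
      qed
      also have "\<dots> \<le> 99 / 100 * max 0 q + (8 / 10 ^ 9 * \<alpha> n + 2 * e)"
      proof -
        have "\<kappa> * q \<le> \<kappa> * max 0 q" using \<kappa>0 by (intro mult_left_mono) auto
        also have "\<dots> \<le> 99 / 100 * max 0 q" using \<kappa>1 by (intro mult_right_mono) auto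
        moreover have "\<kappa> * (8 / 10 ^ 9 * \<alpha> n + 2 * e) \<le> 1 * (8 / 10 ^ 9 * \<alpha> n + 2 * e)"
          using \<kappa>1 a0 e0 by (intro mult_right_mono) auto
        ultimately show ?thesis by (simp add: algebra_simps)
      qed
      finally show "max 0 (c' * \<alpha>' n - s' n * coord F' n - w')
          \<le> 99 / 100 * max 0 (c * \<alpha> n - s n * coord F n - w) + 8 / 10 ^ 9 * \<alpha> n + 2 * e"
        using a0 e0 unfolding q_def by simp
    qed
    also have "\<dots> = 99 / 100 * (\<Sum>n\<in>J. max 0 (c * \<alpha> n - s n * coord F n - w))
        + 8 / 10 ^ 9 * (\<Sum>n\<in>J. \<alpha> n) + 2 * (real (card J) * e)"
      by (simp add: sum.distrib sum_distrib_left)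
    also have "\<dots> \<le> 99 / 100 * (1 / 1000) + 8 / 10 ^ 9 * 750 + 2 * (1 / 10 ^ 8)"
      using D \<alpha>sum ecard by (intro add_mono mult_left_mono) auto
    finally have old: "(\<Sum>n\<in>J. max 0 (c' * \<alpha>' n - s' n * coord F' n - w'))
      \<le> 99 / 100 * (1 / 1000) + 8 / 10 ^ 9 * 750 + 2 * (1 / 10 ^ 8)" .
    \<comment> \<open>The new index explains the form of \<open>c'\<close>: \<open>b\<close> is at
      most about \<open>M - w'\<close>, so \<open>c' * b\<close> is at most about
      \<open>2 * w'\<close>, which the coordinate and the level, each about \<open>w'\<close>,
      cancel.\<close>
    have "c' * \<alpha>' m - s' m * coord F' m - w' = c' * b - \<kappa> * \<bar>coord G m\<bar> - w'"
      using \<sigma>(2) by (simp add: \<alpha>'_def s'_def coord_F' mult.left_commute)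
    also have "c' * b \<le> c' * (M - w' + 1 / 10 ^ 7)"
      using bM \<kappa>m c'0 by (intro mult_left_mono) auto
    also have "c' * (M - w' + 1 / 10 ^ 7) = 2 * w' + c' / 10 ^ 7"
      using Mw' by (simp add: c'_def field_simps)
    finally have "c' * \<alpha>' m - s' m * coord F' m - w' \<le> 14 / 10 ^ 7"
      using \<kappa>m c'13 by simp
    then have new: "max 0 (c' * \<alpha>' m - s' m * coord F' m - w') \<le> 14 / 10 ^ 7"
      by (rule max.boundedI[rotated]) simp
    have "(\<Sum>n\<in>insert m J. max 0 (c' * \<alpha>' n - s' n * coord F' n - w'))
      = max 0 (c' * \<alpha>' m - s' m * coord F' m - w') + (\<Sum>n\<in>J. max 0 (c' * \<alpha>' n - s' n * coord F' n - w'))"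
      using J mJ by simp
    also have "\<dots> \<le> 14 / 10 ^ 7 + (99 / 100 * (1 / 1000) + 8 / 10 ^ 9 * 750 + 2 * (1 / 10 ^ 8))"
      using new old by (rule add_mono)
    also have "\<dots> \<le> 1 / 1000" by simp
    finally show ?thesis .
  qed
  have "config w' F' (insert m J) \<alpha>' s' L"
    unfolding config_def P'_def[symmetric] c'_def[symmetric] F'P'
  proof (intro conjI)
    show "\<forall>n\<in>insert m J. 0 \<le> \<alpha>' n" using b0 \<kappa>0 \<alpha>0 by (auto simp: \<alpha>'_def)
    show "\<forall>n\<in>insert m J. s' n \<in> {1, -1}" using s1 \<sigma>(1) by (auto simp: s'_def)
    show "\<exists>n. w' - 1 / 10 ^ 7 \<le> \<bar>coord F' n\<bar>"
      using \<kappa>m \<kappa>0 by (intro exI[of _ m]) (simp add: coord_F' abs_mult)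
  qed (use J w'0 Mw' vb tight' nice' TF' sum' D' in auto)
  then show ?thesis unfolding w'_def by blast
qed

text \<open>Otherwise every level \<open>k / 10 ^ 9\<close> is reached from level 0, against the
  clause \<open>w \<le> M - 1\<close> of \<open>config\<close>.\<close>

lemma M_gt: "15 / 2 < M"
proof (rule ccontr)
  assume "\<not> 15 / 2 < M"
  then have M: "M \<le> 15 / 2" by simp
  have all: "\<exists>F J \<alpha> s N. config (real k / 10 ^ 9) F J \<alpha> s N" for k
  proof (induction k)
    case 0
    have "config (real 0 / 10 ^ 9) 0 {0} (\<lambda>_. 1 / norm (g 0)) (\<lambda>_. 1) 0"
      using config_0[OF M] by simp
    then show ?case by blast
  next
    case (Suc k)
    then obtain F J \<alpha> s N where "config (real k / 10 ^ 9) F J \<alpha> s N" by blast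
    from config_step[OF M this] show ?case by (simp add: add_divide_distrib add.commute)
  qed
  obtain k :: nat where k: "10 ^ 9 * M < real k" using reals_Archimedean2 by blast
  from all[of k] have "real k / 10 ^ 9 \<le> M - 1" by (auto simp: config_def)
  with k show False by simp
qed

end

section \<open>Return to the Banach-Mazur distance\<close>

theorem theorem4p3:
  shows "banach_mazur_dist TYPE(linf01) TYPE(ell_inf) \<ge> ereal 7.41"
  unfolding banach_mazur_dist_def
proof (rule INF_greatest)
  fix T :: "linf01 \<Rightarrow> ell_inf"
  assume "T \<in> {T. bounded_linear T \<and> bij T \<and> bounded_linear (inv T)}"
  then have T: "bounded_linear T" and bij: "bij T" and Q: "bounded_linear (inv T)" by auto
  define q where "q = onorm (inv T)"
  have q0: "0 \<le> q" unfolding q_def by (rule onorm_pos_le[OF Q])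
  have q_le: "norm (inv T y) \<le> q * norm y" for y unfolding q_def by (rule onorm[OF Q])
  have "q \<noteq> 0"
  proof
    assume "q = 0"
    then have "inv T (unit_seq 0) = 0" using q_le[of "unit_seq 0"] by simp
    then have "T 0 = unit_seq 0" using bij by (metis bij_inv_eq_iff)
    then have "apply_bcontfun (unit_seq 0) 0 = 0" using linear_0[OF bounded_linear.linear[OF T]] by simp
    then show False by simp
  qed
  with q0 have q: "0 < q" by simp
  \<comment> \<open>Scaling by \<open>q\<close> moves the whole product of the two norms into the
    constant \<open>M\<close>, to which the bound \<open>15 / 2 > 7.41\<close> applies.\<close>
  interpret linf_ell_iso "\<lambda>f. q *\<^sub>R T f" "\<lambda>y. (1 / q) *\<^sub>R inv T y" "q * onorm T"
  proof (rule linf_ell_iso.intro)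
    show "linear (\<lambda>f. q *\<^sub>R T f)" "linear (\<lambda>y. (1 / q) *\<^sub>R inv T y)"
      using T Q by (auto intro!: linear_compose_scale_right dest: bounded_linear.linear)
    show "q *\<^sub>R T ((1 / q) *\<^sub>R inv T y) = y" for y
      using q bij by (simp add: linear_scale[OF bounded_linear.linear[OF T]] bij_is_surj surj_f_inv_f)
    show "(1 / q) *\<^sub>R inv T (q *\<^sub>R T f) = f" for f
      using q bij by (simp add: linear_scale[OF bounded_linear.linear[OF Q]] bij_is_inj)
    show "norm ((1 / q) *\<^sub>R inv T y) \<le> norm y" for y
      using q q_le[of y] by (simp add: divide_le_eq mult.commute)
    show "norm (q *\<^sub>R T f) \<le> q * onorm T * norm f" for f
      using onorm[OF T, of f] q by (simp add: mult.assoc)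
  qed
  show "ereal 7.41 \<le> ereal (onorm T * onorm (inv T))"
    using M_gt by (simp add: q_def mult.commute)
qed

end
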